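(* Every word of length $18$ over the binary alphabet $\{a,b\}$ that does not contain the factor $bb$ contains an abelian $4$-power. This bound is tight: the word $babaaabaaabaaabab$ of length $17$ does not contain the factor $bb$ and does not contain an abelian $4$-power.
   Context: A factor of a word is a contiguous subword. A word contains an abelian $k$-power if it has a factor of the form $v_1v_2\cdots v_k$ where $v_1,\dots,v_k$ are non-empty words that are permutations (anagrams) of one another. *)

theory Defs
  imports "HOL-Library.Multiset" "HOL-Library.Sublist"
begin

datatype letter = A | B

(* Factors (contiguous subwords) are expressed by the library relation sublist;
   words are permutations of one another iff their multisets of letters coincide. *)

definition abelian_power :: "nat \<Rightarrow> 'a list \<Rightarrow> bool" where
  "abelian_power k w \<longleftrightarrow>
     (\<exists>vs. length vs = k \<and> w = concat vs \<and>
           (\<forall>v\<in>set vs. v \<noteq> []) \<and>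
           (\<forall>u\<in>set vs. \<forall>v\<in>set vs. mset u = mset v))"

definition contains_abelian_power :: "nat \<Rightarrow> 'a list \<Rightarrow> bool" where
  "contains_abelian_power k w \<longleftrightarrow> (\<exists>u. sublist u w \<and> abelian_power k u)"

end

(* Avoiding bb and abelian 4-powers is inherited by suffixes, so the admissible words of length n + 1 are found by
   prepending a letter to those of length n, and only prefixes of the new word have to be tested.
   At most 67 words survive at any length (the maximum occurs at length 11) and none at length 18,
   so the search can be carried out by rewriting in the kernel. *)

theory Submission
  imports Defs
begin

text \<open>A canonical representative of the anagram class: it turns equality of multisets into
  equality of lists, which can be decided by plain rewriting.\<close>

definition letter_sort :: "letter list \<Rightarrow> letter list" where
  "letter_sort w = filter (\<lambda>x. x = A) w @ filter (\<lambda>x. x = B) w"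

lemma mset_letter_sort: "mset (letter_sort w) = mset w"
proof (induction w)
  case (Cons x w)
  then show ?case
    by (cases x) (auto simp: letter_sort_def)
qed (simp add: letter_sort_def)

lemma letter_sort_eq_iff: "letter_sort u = letter_sort v \<longleftrightarrow> mset u = mset v"
proof
  assume "mset u = mset v"
  moreover have "filter (\<lambda>x. x = a) w = replicate (count (mset w) a) a" for a :: letter and w
    by (induction w) auto
  ultimately show "letter_sort u = letter_sort v"
    by (simp add: letter_sort_def)
qed (metis mset_letter_sort)

text \<open>The conditionals make the simplifier skip the branches that are not needed when these
  functions are evaluated by rewriting; conjunctions would be evaluated on both sides.\<close>

fun anagram_prefix :: "nat \<Rightarrow> letter list \<Rightarrow> letter list \<Rightarrow> bool" where
  "anagram_prefix 0 v w \<longleftrightarrow> True"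
| "anagram_prefix (Suc k) v w \<longleftrightarrow>
     (if letter_sort (take (length v) w) = letter_sort v
      then anagram_prefix k v (drop (length v) w) else False)"

text \<open>\<open>take\<close> shortens silently when \<open>w\<close> runs out, but a shortened
  block could not have the same multiset as \<open>v\<close>; so each successful test consumes
  \<open>length v\<close> letters.\<close>

lemma anagram_prefix_length: "anagram_prefix k v w \<Longrightarrow> k * length v \<le> length w"
proof (induction k arbitrary: w)
  case (Suc k)
  then have "length (take (length v) w) = length v" "k * length v \<le> length (drop (length v) w)"
    by (auto simp: letter_sort_eq_iff simp del: length_take length_drop
        split: if_splits intro: mset_eq_length)
  then show ?case by simp
qed simp

text \<open>Anagrams have equal length, so the blocks of any suitable \<open>vs\<close> are forced
  to be the successive pieces of length \<open>length v\<close>; cutting greedily misses no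
  choice.\<close>

lemma anagram_prefix_iff:
  "anagram_prefix k v w \<longleftrightarrow>
     (\<exists>vs. length vs = k \<and> prefix (concat vs) w \<and> (\<forall>u\<in>set vs. mset u = mset v))"
proof (induction k arbitrary: w)
  case 0
  then show ?case by simp
next
  case (Suc k)
  show ?case
  proof
    assume "anagram_prefix (Suc k) v w"
    then obtain vs where "mset (take (length v) w) = mset v" "length vs = k"
        "prefix (concat vs) (drop (length v) w)" "\<forall>u\<in>set vs. mset u = mset v"
      using Suc.IH by (auto simp: letter_sort_eq_iff split: if_splits)
    moreover from this have "prefix (concat (take (length v) w # vs)) w"
      by (metis append_take_drop_id concat.simps(2) same_prefix_prefix)
    ultimately show "\<exists>vs. length vs = Suc k \<and> prefix (concat vs) w \<and> (\<forall>u\<in>set vs. mset u = mset v)"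
      by (intro exI[of _ "take (length v) w # vs"]) auto
  next
    assume "\<exists>vs. length vs = Suc k \<and> prefix (concat vs) w \<and> (\<forall>u\<in>set vs. mset u = mset v)"
    then obtain u us where us: "length us = k" "prefix (u @ concat us) w"
        "mset u = mset v" "\<forall>u\<in>set us. mset u = mset v"
      by (auto simp: length_Suc_conv)
    moreover have "length u = length v"
      using us(3) by (rule mset_eq_length)
    ultimately show "anagram_prefix (Suc k) v w"
      using Suc.IH by (auto simp: prefix_def letter_sort_eq_iff)
  qed
qed

text \<open>\<open>m\<close> is the length of the first block. Starting at 1 excludes empty blocks,
  and \<open>k\<close> blocks of length \<open>m\<close> fit into \<open>w\<close> only if
  \<open>m \<le> length w div k\<close>, so the search is finite.\<close>

definition abelian_power_prefix :: "nat \<Rightarrow> letter list \<Rightarrow> bool" where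
  "abelian_power_prefix k w \<longleftrightarrow>
     (\<exists>m\<in>set [1..<Suc (length w div k)]. anagram_prefix (k - 1) (take m w) (drop m w))"

lemma abelian_power_prefix_iff:
  assumes "k > 0"
  shows "abelian_power_prefix k w \<longleftrightarrow> (\<exists>u. prefix u w \<and> abelian_power k u)"
proof
  assume "abelian_power_prefix k w"
  then obtain m vs where m: "1 \<le> m" "m \<le> length w div k" and vs: "length vs = k - 1"
      "prefix (concat vs) (drop m w)" "\<forall>u\<in>set vs. mset u = mset (take m w)"
    by (auto simp: abelian_power_prefix_def anagram_prefix_iff)
  have ne: "take m w \<noteq> []"
    using m assms by (auto simp: Suc_le_eq)
  have "abelian_power k (concat (take m w # vs))"
    unfolding abelian_power_def using vs ne assms
    by (intro exI[of _ "take m w # vs"]) (auto simp del: take_eq_Nil)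
  moreover have "prefix (concat (take m w # vs)) w"
    using vs(2) by (metis append_take_drop_id concat.simps(2) same_prefix_prefix)
  ultimately show "\<exists>u. prefix u w \<and> abelian_power k u" by blast
next
  assume "\<exists>u. prefix u w \<and> abelian_power k u"
  then obtain vs where vs: "length vs = k" "prefix (concat vs) w"
      "\<forall>v\<in>set vs. v \<noteq> []" "\<forall>u\<in>set vs. \<forall>v\<in>set vs. mset u = mset v"
    by (auto simp: abelian_power_def)
  then obtain v us where v: "vs = v # us"
    using assms by (cases vs) auto
  from vs(2) obtain z where z: "w = v @ concat us @ z"
    by (auto simp: v prefix_def)
  have *: "anagram_prefix (k - 1) (take (length v) w) (drop (length v) w)"
    unfolding anagram_prefix_iff
  proof (intro exI conjI)
    show "length us = k - 1"
      using vs(1) v by simp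
    show "prefix (concat us) (drop (length v) w)"
      using z by simp
    show "\<forall>u\<in>set us. mset u = mset (take (length v) w)"
    proof -
      have "take (length v) w = v"
        using z by simp
      then show ?thesis
        using vs(4) unfolding v by (metis list.set_intros)
    qed
  qed
  \<comment> \<open>The first block and the \<open>k - 1\<close> blocks after it all fit into
    \<open>w\<close>, which puts \<open>length v\<close> inside the search range.\<close>
  have "k * length v = length v + (k - 1) * length v"
    using assms by (cases k) auto
  also have "\<dots> \<le> length w"
    using anagram_prefix_length[OF *] z by simp
  finally have "length v \<le> length w div k"
    using assms by (simp add: less_eq_div_iff_mult_less_eq mult.commute)
  moreover have "length v > 0"
    using vs(3) v by simp
  ultimately have "length v \<in> set [1..<Suc (length w div k)]"
    unfolding set_upt by (intro atLeastLessThan_iff[THEN iffD2]) linarith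
  with * show "abelian_power_prefix k w"
    unfolding abelian_power_prefix_def by blast
qed

text \<open>A factor of \<open>x # w\<close> either starts at \<open>x\<close>, and is then a
  prefix, or lies within \<open>w\<close>.\<close>

lemma contains_abelian_power_Cons:
  assumes "k > 0"
  shows "contains_abelian_power k (x # w) \<longleftrightarrow>
    abelian_power_prefix k (x # w) \<or> contains_abelian_power k w"
  unfolding contains_abelian_power_def abelian_power_prefix_iff[OF assms] sublist_Cons_right
  by blast

text \<open>A power with at least one block is non-empty because its blocks are. For
  \<open>k = 0\<close> the empty list of blocks would make \<open>[]\<close> a power.\<close>

lemma not_contains_abelian_power_Nil:
  assumes "k > 0"
  shows "\<not> contains_abelian_power k []"
proof -
  have "\<not> abelian_power k []"
    using assms by (metis abelian_power_def concat_eq_Nil_conv length_0_conv list.set_intros(1)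
        neq_Nil_conv not_gr_zero)
  then show ?thesis
    by (simp add: contains_abelian_power_def)
qed

fun good :: "letter list \<Rightarrow> bool" where
  "good [] \<longleftrightarrow> True"
| "good (x # w) \<longleftrightarrow>
     good w \<and> take 2 (x # w) \<noteq> [B, B] \<and> \<not> abelian_power_prefix 4 (x # w)"

lemma good_iff: "good w \<longleftrightarrow> \<not> sublist [B, B] w \<and> \<not> contains_abelian_power 4 w"
proof (induction w)
  case Nil
  then show ?case by (simp add: not_contains_abelian_power_Nil)
next
  case (Cons x w)
  \<comment> \<open>This holds for a one-letter word too: \<open>take 2\<close> then returns a list
    of length 1, which differs from \<open>[B, B]\<close>.\<close>
  have "take 2 (x # w) = [B, B] \<longleftrightarrow> prefix [B, B] (x # w)"
    by (cases w) (auto simp: take_Suc_Cons numeral_2_eq_2)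
  with Cons.IH show ?case
    by (simp add: contains_abelian_power_Cons sublist_Cons_right del: Cons_prefix_Cons) blast
qed

fun good_words :: "nat \<Rightarrow> letter list list" where
  "good_words 0 = [[]]"
| "good_words (Suc n) =
     filter (\<lambda>w. if take 2 w = [B, B] then False else \<not> abelian_power_prefix 4 w)
       (concat (map (\<lambda>w. [A # w, B # w]) (good_words n)))"

lemma set_good_words: "set (good_words n) = {w. length w = n \<and> good w}"
proof (induction n)
  case (Suc n)
  have "w \<in> set (good_words (Suc n)) \<longleftrightarrow> length w = Suc n \<and> good w" for w
  proof (cases w)
    case (Cons x v)
    \<comment> \<open>With only two letters, the two extensions of each good tail exhaust all
      candidates.\<close>
    have "x = A \<or> x = B"
      by (cases x) auto
    with Suc.IH Cons show ?thesis
      by auto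
  qed auto
  then show ?case
    by blast
qed auto

lemma good_words_18: "good_words 18 = []"
  by code_simp

lemma good_word_17: "good [B, A, B, A, A, A, B, A, A, A, B, A, A, A, B, A, B]"
  by code_simp

theorem proposition4p1:
  shows "(\<forall>w :: letter list.
            length w = 18 \<and> \<not> sublist [B, B] w \<longrightarrow> contains_abelian_power 4 w) \<and>
         (let u = [B, A, B, A, A, A, B, A, A, A, B, A, A, A, B, A, B]
          in length u = 17 \<and> \<not> sublist [B, B] u \<and> \<not> contains_abelian_power 4 u)"
proof -
  have "contains_abelian_power 4 w" if "length w = 18" "\<not> sublist [B, B] w" for w :: "letter list"
  proof (rule ccontr)
    assume "\<not> contains_abelian_power 4 w"
    with that have "w \<in> set (good_words 18)"
      unfolding set_good_words good_iff by blast
    then show False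
      unfolding good_words_18 by simp
  qed
  with good_word_17 show ?thesis
    unfolding Let_def good_iff by simp
qed

end
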